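(* For every total function $f:\omega\to\omega$ approximable from above, there exists a total function $g$ which is $2$-approximable from below and such that $g\not\le_m f$, i.e., there is no total computable $h$ with $g=f\circ h$.
   Context: A total $f$ is approximable from above if $f(x)=\lim_s g'(x,s)$ for a total computable $g'$ with $g'(x,s+1)\le g'(x,s)$. A total $g$ is $2$-approximable from below if $g(x)=\lim_s k(x,s)$ for a total computable $k$ with $k(x,s+1)\ge k(x,s)$ for all $x,s$ and $|\{s: k(x,s)\ne k(x,s+1)\}|\le 2$ for all $x$. *)

theory Defs
  imports Complex_Main
begin

text \<open>
  Computability is rendered through Kleene's \<mu>-recursive functions. The library has no such notion,
  so they are given by terms together with an inductively defined evaluation relation.
  Terms carry no arity annotation: on argument lists of a fixed length \<open>n\<close>, \<open>Zero\<close> is the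
  \<open>n\<close>-ary constant zero function, \<open>Proj i\<close> the \<open>n\<close>-ary projection to the argument with
  index \<open>i\<close> (counted from \<open>0\<close>), and so on. A term that makes no
  sense at a given arity, such as \<open>Succ\<close> on two arguments, has no value there.
\<close>

datatype recf =
    Zero
  | Succ
  | Proj nat
  | Comp recf "recf list"
  | PrimRec recf recf
  | Mu recf

inductive evaluates :: "recf \<Rightarrow> nat list \<Rightarrow> nat \<Rightarrow> bool" where
  Zero: "evaluates Zero xs 0"
| Succ: "evaluates Succ [x] (Suc x)"
| Proj: "i < length xs \<Longrightarrow> evaluates (Proj i) xs (xs ! i)"
| Comp: "list_all2 (\<lambda>g y. evaluates g xs y) gs ys \<Longrightarrow> evaluates f ys z \<Longrightarrow>
    evaluates (Comp f gs) xs z"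
| PrimRec_0: "evaluates f xs y \<Longrightarrow> evaluates (PrimRec f g) (0 # xs) y"
| PrimRec_Suc: "evaluates (PrimRec f g) (n # xs) y \<Longrightarrow> evaluates g (n # y # xs) z \<Longrightarrow>
    evaluates (PrimRec f g) (Suc n # xs) z"
| Mu: "evaluates f (n # xs) 0 \<Longrightarrow> (\<And>m. m < n \<Longrightarrow> \<exists>y. evaluates f (m # xs) (Suc y)) \<Longrightarrow>
    evaluates (Mu f) xs n"

text \<open>Evaluation is single-valued, so every term denotes a partial function of each arity.\<close>

lemma evaluates_deterministic:
  assumes "evaluates c xs y" and "evaluates c xs y'"
  shows "y = y'"
  using assms
proof (induction arbitrary: y' rule: evaluates.induct)
  case (Zero xs)
  then show ?case by (cases rule: evaluates.cases) auto
next
  case (Succ x)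
  then show ?case by (cases rule: evaluates.cases) auto
next
  case (Proj i xs)
  from Proj.prems show ?case by (cases rule: evaluates.cases) auto
next
  case (Comp xs gs ys f z)
  from Comp.prems obtain ys' where ys': "list_all2 (\<lambda>g y. evaluates g xs y) gs ys'"
    and z': "evaluates f ys' y'"
    by (cases rule: evaluates.cases) auto
  have "ys = ys'"
    using Comp.IH(1) ys' by (auto simp: list_all2_conv_all_nth intro!: nth_equalityI)
  with z' Comp.IH(2) show ?case by simp
next
  case (PrimRec_0 f xs y g)
  from PrimRec_0.prems PrimRec_0.IH show ?case by (cases rule: evaluates.cases) auto
next
  case (PrimRec_Suc f g n xs y z)
  from PrimRec_Suc.prems PrimRec_Suc.IH show ?case by (cases rule: evaluates.cases) auto
next
  case (Mu f n xs)
  from Mu.prems have 0: "evaluates f (y' # xs) 0"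
    and pos: "\<And>m. m < y' \<Longrightarrow> \<exists>y. evaluates f (m # xs) (Suc y)"
    by (cases rule: evaluates.cases; auto)+
  show ?case
    using Mu.IH(1) Mu.IH(2) 0 pos by (metis nat.distinct(1) linorder_neqE_nat)
qed

definition computable1 :: "(nat \<Rightarrow> nat) \<Rightarrow> bool" where
  "computable1 h \<longleftrightarrow> (\<exists>c. \<forall>x. evaluates c [x] (h x))"

definition computable2 :: "(nat \<Rightarrow> nat \<Rightarrow> nat) \<Rightarrow> bool" where
  "computable2 k \<longleftrightarrow> (\<exists>c. \<forall>x s. evaluates c [x, s] (k x s))"

text \<open>Limits of sequences of naturals are taken in the discrete topology of \<^typ>\<open>nat\<close>.\<close>

definition approximable_from_above :: "(nat \<Rightarrow> nat) \<Rightarrow> bool" where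
  "approximable_from_above f \<longleftrightarrow>
    (\<exists>g'. computable2 g' \<and> (\<forall>x s. g' x (Suc s) \<le> g' x s) \<and>
      (\<forall>x. (\<lambda>s. g' x s) \<longlonglongrightarrow> f x))"

definition n_approximable_from_below :: "nat \<Rightarrow> (nat \<Rightarrow> nat) \<Rightarrow> bool" where
  "n_approximable_from_below n g \<longleftrightarrow>
    (\<exists>k. computable2 k \<and> (\<forall>x s. k x s \<le> k x (Suc s)) \<and>
      (\<forall>x. finite {s. k x s \<noteq> k x (Suc s)} \<and> card {s. k x s \<noteq> k x (Suc s)} \<le> n) \<and>
      (\<forall>x. (\<lambda>s. k x s) \<longlonglongrightarrow> g x))"

definition many_one_reducible :: "(nat \<Rightarrow> nat) \<Rightarrow> (nat \<Rightarrow> nat) \<Rightarrow> bool" (infix "\<le>\<^sub>m" 50) where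
  "g \<le>\<^sub>m f \<longleftrightarrow> (\<exists>h. computable1 h \<and> g = f \<circ> h)"

end

theory Submission
  imports Defs "HOL-Library.Nat_Bijection"
begin

text \<open>
  Fix a decreasing approximation \<open>g'\<close> of \<open>f\<close> and let \<open>k x s = 1\<close> if the program with code \<open>x\<close>, run
  on its own code, halts within \<open>s\<close> steps with an output \<open>y\<close> such that \<open>g' y s = 0\<close>, and
  \<open>k x s = 0\<close> otherwise. As \<open>g' y s = 0\<close> persists, \<open>k\<close> increases at most once, and its limit is
  \<open>1\<close> exactly when the output \<open>y\<close> satisfies \<open>f y = 0\<close>. Hence it differs from \<open>f \<circ> h\<close> at any code
  of a program for \<open>h\<close>.

  To see that \<open>k\<close> is computable, programs are run by a stack machine whose states are natural
  numbers built by pairing. Since the machine is deterministic, it suffices to show that it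
  reaches the right output whenever a program has a value.
\<close>

section \<open>Closure properties of the computable functions\<close>

lemma computable1_id: "computable1 (\<lambda>x. x)"
  unfolding computable1_def using evaluates.Proj[of 0 "[_]"] by auto

lemma computable1_comp:
  assumes "computable1 f" "computable1 g"
  shows "computable1 (\<lambda>x. f (g x))"
proof -
  obtain c d where "\<And>x. evaluates c [x] (f x)" "\<And>x. evaluates d [x] (g x)"
    using assms unfolding computable1_def by blast
  then have "evaluates (Comp c [d]) [x] (f (g x))" for x
    by (intro evaluates.Comp[where ys = "[g x]"]) auto
  then show ?thesis unfolding computable1_def by blast
qed

lemma computable1_comp2:
  assumes "computable2 f" "computable1 g" "computable1 h"
  shows "computable1 (\<lambda>x. f (g x) (h x))"
proof -
  obtain c d e where "\<And>x y. evaluates c [x, y] (f x y)"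
    "\<And>x. evaluates d [x] (g x)" "\<And>x. evaluates e [x] (h x)"
    using assms unfolding computable1_def computable2_def by blast
  then have "evaluates (Comp c [d, e]) [x] (f (g x) (h x))" for x
    by (intro evaluates.Comp[where ys = "[g x, h x]"]) auto
  then show ?thesis unfolding computable1_def by blast
qed

lemma computable2_comp1:
  assumes "computable1 f" "computable2 g"
  shows "computable2 (\<lambda>x y. f (g x y))"
proof -
  obtain c d where "\<And>x. evaluates c [x] (f x)" "\<And>x y. evaluates d [x, y] (g x y)"
    using assms unfolding computable1_def computable2_def by blast
  then have "evaluates (Comp c [d]) [x, y] (f (g x y))" for x y
    by (intro evaluates.Comp[where ys = "[g x y]"]) auto
  then show ?thesis unfolding computable2_def by blast
qed

lemma computable2_comp2:
  assumes "computable2 f" "computable2 g" "computable2 h"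
  shows "computable2 (\<lambda>x y. f (g x y) (h x y))"
proof -
  obtain c d e where "\<And>x y. evaluates c [x, y] (f x y)"
    "\<And>x y. evaluates d [x, y] (g x y)" "\<And>x y. evaluates e [x, y] (h x y)"
    using assms unfolding computable2_def by blast
  then have "evaluates (Comp c [d, e]) [x, y] (f (g x y) (h x y))" for x y
    by (intro evaluates.Comp[where ys = "[g x y, h x y]"]) auto
  then show ?thesis unfolding computable2_def by blast
qed

lemma computable2_fst: "computable2 (\<lambda>x y. x)"
  unfolding computable2_def using evaluates.Proj[of 0 "[_, _]"] by auto

lemma computable2_snd: "computable2 (\<lambda>x y. y)"
  unfolding computable2_def using evaluates.Proj[of 1 "[_, _]"] by auto

lemma computable1_Suc:
  assumes "computable1 f"
  shows "computable1 (\<lambda>x. Suc (f x))"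
proof -
  have "computable1 Suc"
    unfolding computable1_def using evaluates.Succ by blast
  then show ?thesis using assms by (rule computable1_comp)
qed

lemma computable1_const: "computable1 (\<lambda>x. n)"
proof (induction n)
  case 0
  then show ?case unfolding computable1_def using evaluates.Zero by blast
qed (rule computable1_Suc)

text \<open>Iteration is primitive recursion on the iteration count. It yields addition, truncated
  subtraction and the bounded runs of the machine.\<close>

lemma computable2_funpow:
  assumes "computable1 f"
  shows "computable2 (\<lambda>n x. (f ^^ n) x)"
proof -
  obtain c where c: "\<And>x. evaluates c [x] (f x)"
    using assms unfolding computable1_def by blast
  let ?c = "PrimRec (Proj 0) (Comp c [Proj 1])"
  have "evaluates ?c [n, x] ((f ^^ n) x)" for n x
  proof (induction n)
    case 0
    then show ?case using evaluates.Proj[of 0 "[x]"] by (auto intro: evaluates.PrimRec_0)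
  next
    case (Suc n)
    let ?y = "(f ^^ n) x"
    have "evaluates (Comp c [Proj 1]) [n, ?y, x] (f ?y)"
      using evaluates.Proj[of 1 "[n, ?y, x]"] c by (intro evaluates.Comp[where ys = "[?y]"]) auto
    with Suc show ?case using evaluates.PrimRec_Suc by simp
  qed
  then show ?thesis unfolding computable2_def by blast
qed

lemma computable1_if_zero:
  assumes "computable1 f" "computable1 g" "computable1 h"
  shows "computable1 (\<lambda>x. if f x = 0 then g x else h x)"
proof -
  obtain c d e where cde: "\<And>x. evaluates c [x] (f x)"
    "\<And>x. evaluates d [x] (g x)" "\<And>x. evaluates e [x] (h x)"
    using assms unfolding computable1_def by blast
  \<comment> \<open>The recursion runs on the test value. Its step sees the counter, the previous
    value, \<open>a\<close> and \<open>b\<close>; \<open>Proj 3\<close> discards all but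
    \<open>b\<close>.\<close>
  let ?c = "PrimRec (Proj 0) (Proj 3)"
  have "evaluates ?c [n, a, b] (if n = 0 then a else b)" for n a b
  proof (induction n)
    case 0
    then show ?case using evaluates.Proj[of 0 "[a, b]"] by (auto intro: evaluates.PrimRec_0)
  next
    case (Suc n)
    then show ?case
      using evaluates.PrimRec_Suc[OF Suc] evaluates.Proj[of 3 "[n, if n = 0 then a else b, a, b]"]
      by simp
  qed
  with cde have "evaluates (Comp ?c [c, d, e]) [x] (if f x = 0 then g x else h x)" for x
    by (intro evaluates.Comp[where ys = "[f x, g x, h x]"]) auto
  then show ?thesis unfolding computable1_def by blast
qed

lemma computable1_Least:
  assumes "computable2 f" and zero: "\<And>x. \<exists>n. f n x = 0"
  shows "computable1 (\<lambda>x. LEAST n. f n x = 0)"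
proof -
  obtain c where c: "\<And>n x. evaluates c [n, x] (f n x)"
    using assms unfolding computable2_def by blast
  have "evaluates (Mu c) [x] (LEAST n. f n x = 0)" for x
  proof (rule evaluates.Mu)
    show "evaluates c [LEAST n. f n x = 0, x] 0"
      using c[of "LEAST n. f n x = 0" x] LeastI_ex[OF zero[of x]] by simp
    show "\<exists>y. evaluates c [m, x] (Suc y)" if "m < (LEAST n. f n x = 0)" for m
      using not_less_Least[OF that] c[of m x] by (metis not0_implies_Suc)
  qed
  then show ?thesis unfolding computable1_def by blast
qed

lemma computable2_add: "computable2 (+)"
proof -
  have "(Suc ^^ n) x = n + x" for n x by (induction n) auto
  then show ?thesis using computable2_funpow[OF computable1_Suc[OF computable1_id]] by simp
qed

lemma computable1_pred:
  assumes "computable1 f"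
  shows "computable1 (\<lambda>x. f x - 1)"
proof -
  \<comment> \<open>In the recursion step \<open>Proj 0\<close> returns the counter, which is
    already the predecessor.\<close>
  have "evaluates (PrimRec Zero (Proj 0)) [n] (n - 1)" for n
  proof (induction n)
    case 0
    then show ?case by (auto intro: evaluates.PrimRec_0 evaluates.Zero)
  next
    case (Suc n)
    then show ?case
      using evaluates.PrimRec_Suc[OF Suc] evaluates.Proj[of 0 "[n, n - 1]"] by simp
  qed
  then have "computable1 (\<lambda>n. n - 1)" unfolding computable1_def by blast
  then show ?thesis using assms by (rule computable1_comp)
qed

lemma computable2_diff: "computable2 (\<lambda>x y. x - y)"
proof -
  have "((\<lambda>x. x - 1) ^^ n) x = x - n" for n x :: nat by (induction n) auto
  then have "computable2 (\<lambda>n x. x - n)"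
    using computable2_funpow[OF computable1_pred[OF computable1_id]] by simp
  from computable2_comp2[OF this computable2_snd computable2_fst] show ?thesis .
qed

lemmas computable1_add = computable1_comp2[OF computable2_add]
  and computable1_diff = computable1_comp2[OF computable2_diff]

lemma computable1_if_eq:
  assumes "computable1 f" "computable1 g" "computable1 a" "computable1 b"
  shows "computable1 (\<lambda>x. if f x = g x then a x else b x)"
proof -
  have "computable1 (\<lambda>x. if (f x - g x) + (g x - f x) = 0 then a x else b x)"
    using assms by (intro computable1_if_zero computable1_add computable1_diff)
  moreover have "f x = g x \<longleftrightarrow> (f x - g x) + (g x - f x) = 0" for x by auto
  ultimately show ?thesis by simp
qed

section \<open>Pairing\<close>

definition pair :: "nat \<Rightarrow> nat \<Rightarrow> nat" where
  "pair a b = prod_encode (a, b)"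

definition pfst :: "nat \<Rightarrow> nat" where
  "pfst z = fst (prod_decode z)"

definition psnd :: "nat \<Rightarrow> nat" where
  "psnd z = snd (prod_decode z)"

lemma pfst_pair [simp]: "pfst (pair a b) = a"
  and psnd_pair [simp]: "psnd (pair a b) = b"
  by (simp_all add: pfst_def psnd_def pair_def)

lemma pair_pfst_psnd [simp]: "pair (pfst z) (psnd z) = z"
  by (simp add: pfst_def psnd_def pair_def)

lemma pair_0_0 [simp]: "pair 0 0 = 0"
  by (simp add: pair_def prod_encode_def)

lemma pfst_0 [simp]: "pfst 0 = 0"
  by (metis pair_0_0 pfst_pair)

lemma computable1_triangle:
  assumes "computable1 f"
  shows "computable1 (\<lambda>x. triangle (f x))"
proof -
  have "computable2 (\<lambda>n y. y + Suc n)"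
    by (intro computable2_comp2[OF computable2_add] computable2_comp1[of Suc]
        computable2_fst computable2_snd computable1_Suc computable1_id)
  then obtain c where c: "\<And>n y. evaluates c [n, y] (y + Suc n)"
    unfolding computable2_def by blast
  have "evaluates (PrimRec Zero c) [n] (triangle n)" for n
  proof (induction n)
    case 0
    then show ?case by (auto intro: evaluates.PrimRec_0 evaluates.Zero)
  next
    case (Suc n)
    then show ?case using evaluates.PrimRec_Suc[OF Suc] c[of n "triangle n"] by simp
  qed
  then have "computable1 triangle" unfolding computable1_def by blast
  then show ?thesis using assms by (rule computable1_comp)
qed

lemma computable1_pair:
  assumes "computable1 f" "computable1 g"
  shows "computable1 (\<lambda>x. pair (f x) (g x))"
  unfolding pair_def prod_encode_def split
  by (intro computable1_add computable1_triangle assms)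

lemma triangle_mono: "m \<le> n \<Longrightarrow> triangle m \<le> triangle n"
  by (induction n rule: dec_induct) auto

text \<open>The largest \<open>w\<close> with \<open>triangle w\<close> \<le> \<open>z\<close>, that
  is, the diagonal of Cantor's pairing on which \<open>z\<close> lies. It is phrased as a least zero
  so that unbounded search computes it.\<close>

definition triangle_root :: "nat \<Rightarrow> nat" where
  "triangle_root z = (LEAST w. Suc z - triangle (Suc w) = 0)"

lemma triangle_root_pair: "triangle_root (pair a b) = a + b"
  unfolding triangle_root_def
proof (rule Least_equality)
  show "Suc (pair a b) - triangle (Suc (a + b)) = 0"
    by (simp add: pair_def prod_encode_def)
  show "a + b \<le> w" if "Suc (pair a b) - triangle (Suc w) = 0" for w
  proof (rule ccontr)
    assume "\<not> a + b \<le> w"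
    then have "triangle (Suc w) \<le> triangle (a + b)" by (intro triangle_mono) simp
    with that show False by (simp add: pair_def prod_encode_def)
  qed
qed

lemma computable1_triangle_root: "computable1 triangle_root"
proof -
  have "computable2 (\<lambda>w z. Suc z - triangle (Suc w))"
    by (intro computable2_comp2[OF computable2_diff] computable2_comp1[of Suc]
        computable2_comp1[of "\<lambda>w. triangle (Suc w)"] computable2_fst computable2_snd
        computable1_Suc computable1_triangle computable1_id)
  \<comment> \<open>The witness \<open>z\<close> works since \<open>triangle (Suc z)\<close> is
    \<open>triangle z + Suc z\<close>.\<close>
  moreover have "\<exists>w. Suc z - triangle (Suc w) = 0" for z
    by (rule exI[of _ z]) simp
  ultimately show ?thesis
    using computable1_Least[of "\<lambda>w z. Suc z - triangle (Suc w)"] by (simp add: triangle_root_def[abs_def])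
qed

lemma pfst_eq: "pfst z = z - triangle (triangle_root z)"
  by (subst (2 3) pair_pfst_psnd[symmetric], subst triangle_root_pair)
    (simp add: pair_def prod_encode_def)

lemma psnd_eq: "psnd z = triangle_root z - pfst z"
  by (subst (2) pair_pfst_psnd[symmetric], subst triangle_root_pair) simp

lemma computable1_pfst:
  assumes "computable1 f"
  shows "computable1 (\<lambda>x. pfst (f x))"
  unfolding pfst_eq
  by (intro computable1_diff computable1_triangle computable1_comp[OF computable1_triangle_root] assms)

lemma computable1_psnd:
  assumes "computable1 f"
  shows "computable1 (\<lambda>x. psnd (f x))"
  unfolding psnd_eq
  by (intro computable1_diff computable1_pfst computable1_comp[OF computable1_triangle_root] assms)

text \<open>Reduces binary computability to the unary closure rules, applied to a function of the
  coded pair.\<close>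

lemma computable2_pair:
  assumes "computable1 f"
  shows "computable2 (\<lambda>x y. f (pair x y))"
proof -
  have "computable2 pair"
    unfolding pair_def prod_encode_def
    using computable2_comp2[OF computable2_add computable2_comp1[of triangle] computable2_fst]
      computable2_add computable1_triangle[OF computable1_id] by simp
  with assms show ?thesis by (rule computable2_comp1)
qed

section \<open>A universal machine\<close>

text \<open>
  A state is \<open>pair K d\<close> with a control stack \<open>K\<close> of instructions \<open>pair tag argument\<close> and a data
  stack \<open>d\<close>. Stacks and argument lists are nested pairs ending in \<open>0\<close>; as \<open>pair 0 0 = 0\<close>, the
  empty control stack yields tag \<open>0\<close>, on which the machine stays put. An instruction replaces the
  argument list on top of the data stack by the value of the program. The tags 1, 2, 3, 4, 8, 12
  belong to the constructors of programs; the others are auxiliary: 5 evaluates a list of programs,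
  6 and 7 rearrange the data stack, 9 assembles the arguments of the step function of a primitive
  recursion, and 10 and 11 search for a zero.
\<close>

definition step :: "nat \<Rightarrow> nat" where
  "step z =
    (let i = pfst (pfst z); K = psnd (pfst z); t = pfst i; a = psnd i;
         e = pfst (psnd z); r = psnd (psnd z)
     in if t = 0 then z
        else if t = 1 then pair K (pair 0 r)
        else if t = 2 then pair K (pair (Suc (pfst e)) r)
        else if t = 3 then
          (if a = 0 then pair K (pair (pfst e) r)
           else pair (pair (pair 3 (a - 1)) K) (pair (psnd e) r))
        else if t = 4 then pair (pair (psnd a) (pair (pfst a) K)) (pair e r)
        else if t = 5 then
          pair (pair (psnd a) (pair (pair 6 0) (pair (pfst a) (pair (pair 7 0) K))))
            (pair e (pair e r))
        else if t = 6 then pair K (pair (pfst r) (pair e (psnd r)))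
        else if t = 7 then pair K (pair (pair e (pfst r)) (psnd r))
        else if t = 8 then
          (if pfst e = 0 then pair (pair (pfst a) K) (pair (psnd e) r)
           else pair (pair i (pair (pair 9 0) (pair (psnd a) K)))
             (pair (pair (pfst e - 1) (psnd e)) (pair (pair (pfst e - 1) (psnd e)) r)))
        else if t = 9 then
          pair K (pair (pair (pfst (pfst r)) (pair e (psnd (pfst r)))) (psnd r))
        else if t = 10 then pair (pair a (pair (pair 11 a) K)) (pair e (pair e r))
        else if t = 11 then
          (if e = 0 then pair K (pair (pfst (pfst r)) (psnd r))
           else pair (pair (pair 10 a) K)
             (pair (pair (Suc (pfst (pfst r))) (psnd (pfst r))) (psnd r)))
        else pair (pair (pair 10 a) K) (pair (pair 0 e) r))"

lemma computable1_step: "computable1 step"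
  unfolding step_def[abs_def] Let_def
  by (intro computable1_if_eq computable1_pair computable1_pfst computable1_psnd computable1_Suc
      computable1_pred computable1_const computable1_id)

text \<open>The program list of a composition ends in \<open>pair 1 0\<close>, the code of
  \<open>Zero\<close>: its value 0 is also the empty argument list.\<close>

primrec code :: "recf \<Rightarrow> nat" where
  "code Zero = pair 1 0"
| "code Succ = pair 2 0"
| "code (Proj i) = pair 3 i"
| "code (Comp f gs) =
    pair 4 (pair (code f) (foldr (\<lambda>g p. pair 5 (pair g p)) (map code gs) (pair 1 0)))"
| "code (PrimRec f g) = pair 8 (pair (code f) (code g))"
| "code (Mu f) = pair 12 (code f)"

section \<open>Correctness of the machine on codes of programs\<close>

definition args :: "nat list \<Rightarrow> nat" where
  "args xs = foldr pair xs 0"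

lemma args_simps [simp]: "args [] = 0" "args (x # xs) = pair x (args xs)"
  by (simp_all add: args_def)

definition reaches :: "nat \<Rightarrow> nat \<Rightarrow> bool" where
  "reaches z z' \<longleftrightarrow> (\<exists>n. (step ^^ n) z = z')"

lemma reaches_refl: "reaches z z"
  unfolding reaches_def by (rule exI[of _ 0]) simp

lemma reaches_trans [trans]: "reaches x y \<Longrightarrow> reaches y z \<Longrightarrow> reaches x z"
proof -
  assume "reaches x y" and "reaches y z"
  then obtain m n where "(step ^^ m) x = y" "(step ^^ n) y = z"
    unfolding reaches_def by blast
  then have "(step ^^ (n + m)) x = z" by (simp add: funpow_add)
  then show ?thesis unfolding reaches_def by blast
qed

lemma reaches_step: "reaches (step z) z' \<Longrightarrow> reaches z z'"
  using reaches_trans[of z "step z" z'] exI[of "\<lambda>n. (step ^^ n) z = step z" 1]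
  by (simp add: reaches_def)

lemma reaches_Proj:
  "i < length xs \<Longrightarrow>
    reaches (pair (pair (pair 3 i) K) (pair (args xs) r)) (pair K (pair (xs ! i) r))"
proof (induction xs arbitrary: i)
  case (Cons x xs)
  show ?case
  proof (cases i)
    case 0
    then show ?thesis by - (rule reaches_step, simp add: step_def Let_def reaches_refl)
  next
    case (Suc j)
    then have "reaches (pair (pair (pair 3 j) K) (pair (args xs) r)) (pair K (pair (xs ! j) r))"
      using Cons by simp
    with Suc show ?thesis
      by (intro reaches_step[of "pair (pair (pair 3 i) _) _"]) (simp add: step_def Let_def)
  qed
qed simp

text \<open>Downward induction from the zero \<open>n\<close>: a search started at any
  \<open>m\<close> \<le> \<open>n\<close> ends with \<open>n\<close>. The hypotheses hold for all
  stacks because the body runs above a pending tag 11 and a saved copy of its arguments.\<close>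

lemma reaches_Mu:
  assumes "\<And>K r. reaches (pair (pair c K) (pair (args (n # xs)) r)) (pair K (pair 0 r))"
    and "\<And>m. m < n \<Longrightarrow> \<exists>y. \<forall>K r.
      reaches (pair (pair c K) (pair (args (m # xs)) r)) (pair K (pair (Suc y) r))"
    and "m \<le> n"
  shows "reaches (pair (pair (pair 10 c) K) (pair (args (m # xs)) r)) (pair K (pair n r))"
  using \<open>m \<le> n\<close>
proof (induction m rule: inc_induct)
  case base
  let ?r = "pair (args (n # xs)) r"
  have "reaches (pair (pair c (pair (pair 11 c) K)) (pair (args (n # xs)) ?r))
      (pair (pair (pair 11 c) K) (pair 0 ?r))"
    by (rule assms(1))
  also have "reaches \<dots> (pair K (pair n r))"
    by (rule reaches_step) (simp add: step_def reaches_refl)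
  finally show ?case
    by (intro reaches_step[of "pair (pair (pair 10 c) K) _"]) (simp add: step_def Let_def)
next
  case (step m)
  let ?r = "pair (args (m # xs)) r"
  obtain y where "\<And>K r. reaches (pair (pair c K) (pair (args (m # xs)) r)) (pair K (pair (Suc y) r))"
    using assms(2)[OF \<open>m < n\<close>] by blast
  then have "reaches (pair (pair c (pair (pair 11 c) K)) (pair (args (m # xs)) ?r))
      (pair (pair (pair 11 c) K) (pair (Suc y) ?r))" .
  also have "reaches \<dots> (pair K (pair n r))"
    using step.IH by (intro reaches_step[of "pair (pair (pair 11 c) K) _"]) (simp add: step_def Let_def)
  finally show ?case
    by (intro reaches_step[of "pair (pair (pair 10 c) K) _"]) (simp add: step_def Let_def)
qed

text \<open>Tag 5 duplicates the arguments \<open>e\<close> and evaluates the tail of the list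
  first; tag 6 then brings the copy of \<open>e\<close> back to the top for the head, and tag 7
  prepends the head's value.\<close>

lemma reaches_args:
  assumes "list_all2 (\<lambda>c y. \<forall>K r. reaches (pair (pair c K) (pair e r)) (pair K (pair y r))) cs ys"
  shows "reaches (pair (pair (foldr (\<lambda>c p. pair 5 (pair c p)) cs (pair 1 0)) K) (pair e r))
    (pair K (pair (args ys) r))"
  using assms
proof (induction arbitrary: K r rule: list_all2_induct)
  case Nil
  show ?case by (rule reaches_step) (simp add: step_def reaches_refl)
next
  case (Cons c cs y ys)
  let ?p = "foldr (\<lambda>c p. pair 5 (pair c p)) cs (pair 1 0)"
  let ?K = "pair c (pair (pair 7 0) K)"
  have "reaches (pair (pair ?p (pair (pair 6 0) ?K)) (pair e (pair e r)))
      (pair (pair (pair 6 0) ?K) (pair (args ys) (pair e r)))"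
    by (rule Cons.IH)
  also have "reaches \<dots> (pair ?K (pair e (pair (args ys) r)))"
    by (rule reaches_step) (simp add: step_def reaches_refl)
  also have "reaches \<dots> (pair (pair (pair 7 0) K) (pair y (pair (args ys) r)))"
    using Cons.hyps by blast
  also have "reaches \<dots> (pair K (pair (args (y # ys)) r))"
    by (rule reaches_step) (simp add: step_def reaches_refl)
  finally show ?case
    by (intro reaches_step[of "pair (pair (foldr _ _ _) _) _"]) (simp add: step_def Let_def)
qed

text \<open>Induction on the evaluation. \<open>K\<close> and \<open>r\<close> stay arbitrary
  because subprograms run on top of pending instructions and data.\<close>

lemma reaches_code:
  assumes "evaluates c xs y"
  shows "reaches (pair (pair (code c) K) (pair (args xs) r)) (pair K (pair y r))"
  using assms
proof (induction arbitrary: K r rule: evaluates.induct)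
  case (Zero xs)
  show ?case by (rule reaches_step) (simp add: step_def reaches_refl)
next
  case (Succ x)
  show ?case by (rule reaches_step) (simp add: step_def reaches_refl)
next
  case (Proj i xs)
  then show ?case by (simp add: reaches_Proj)
next
  case (Comp xs gs ys f z)
  let ?p = "foldr (\<lambda>c p. pair 5 (pair c p)) (map code gs) (pair 1 0)"
  have "list_all2 (\<lambda>c y. \<forall>K r. reaches (pair (pair c K) (pair (args xs) r)) (pair K (pair y r)))
      (map code gs) ys"
    using Comp.IH(1) by (auto simp: list_all2_conv_all_nth)
  then have "reaches (pair (pair ?p (pair (code f) K)) (pair (args xs) r))
      (pair (pair (code f) K) (pair (args ys) r))"
    by (rule reaches_args)
  also have "reaches \<dots> (pair K (pair z r))"
    by (rule Comp.IH(2))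
  finally show ?case
    by (intro reaches_step[of "pair (pair (code (Comp f gs)) _) _"]) (simp add: step_def Let_def)
next
  case (PrimRec_0 f xs y g)
  then show ?case
    by (intro reaches_step[of "pair (pair (code (PrimRec f g)) _) _"]) (simp add: step_def Let_def)
next
  case (PrimRec_Suc f g n xs y z)
  \<comment> \<open>Tag 8 keeps a copy of \<open>n # xs\<close> below the recursive call, into which
    tag 9 inserts the value \<open>y\<close>.\<close>
  let ?r = "pair (args (n # xs)) r" and ?K = "pair (code g) K"
  have "reaches (pair (pair (code (PrimRec f g)) (pair (pair 9 0) ?K)) (pair (args (n # xs)) ?r))
      (pair (pair (pair 9 0) ?K) (pair y ?r))"
    by (rule PrimRec_Suc.IH(1))
  also have "reaches \<dots> (pair ?K (pair (args (n # y # xs)) r))"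
    by (rule reaches_step) (simp add: step_def reaches_refl)
  also have "reaches \<dots> (pair K (pair z r))"
    by (rule PrimRec_Suc.IH(2))
  finally show ?case
    by (intro reaches_step[of "pair (pair (code (PrimRec f g)) K) _"]) (simp add: step_def Let_def)
next
  case (Mu f n xs)
  have "reaches (pair (pair (pair 10 (code f)) K) (pair (args (0 # xs)) r)) (pair K (pair n r))"
    using Mu.IH by (intro reaches_Mu) blast+
  then show ?case
    by (intro reaches_step[of "pair (pair (code (Mu f)) _) _"]) (simp add: step_def Let_def)
qed

lemma step_halted: "pfst z = 0 \<Longrightarrow> step z = z"
  by (simp add: step_def Let_def)

definition run :: "nat \<Rightarrow> nat \<Rightarrow> nat" where
  "run x s = (step ^^ s) (pair (pair x 0) (pair (args [x]) 0))"

lemma run_halted: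
  assumes "pfst (run x s) = 0" and "s \<le> t"
  shows "run x t = run x s"
  using assms(2)
proof (induction t rule: dec_induct)
  case (step t)
  then show ?case using step_halted assms(1) by (simp add: run_def)
qed simp

lemma run_code:
  assumes "evaluates c [code c] y"
  shows "\<exists>s. run (code c) s = pair 0 (pair y 0)"
  using reaches_code[OF assms, of 0 0] by (simp add: reaches_def run_def)

lemma computable2_run: "computable2 run"
proof -
  have "computable1 (\<lambda>x. pair (pair x 0) (pair (args [x]) 0))"
    unfolding args_simps by (intro computable1_pair computable1_const computable1_id)
  from computable2_comp2[OF computable2_funpow[OF computable1_step] computable2_snd
      computable2_comp1[OF this computable2_fst]]
  show ?thesis by (simp add: run_def[abs_def])
qed

section \<open>Diagonalisation\<close>

lemma card_changes_le_1:
  fixes a :: "nat \<Rightarrow> nat"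
  assumes "\<And>s. a s \<le> a (Suc s)" and "\<And>s. a s \<le> 1"
  shows "finite {s. a s \<noteq> a (Suc s)} \<and> card {s. a s \<noteq> a (Suc s)} \<le> 1"
proof -
  have mono: "a s \<le> a t" if "s \<le> t" for s t
    using lift_Suc_mono_le[of a] assms(1) that by blast
  \<comment> \<open>Changes at \<open>s\<close> and at a later \<open>t\<close> would raise the
    value twice, hence to at least 2.\<close>
  have less: "\<not> s < t" if "a s \<noteq> a (Suc s)" "a t \<noteq> a (Suc t)" for s t
    using mono[of "Suc s" t] assms(1)[of s] assms(1)[of t] assms(2)[of "Suc t"] that by linarith
  have "s = t" if "a s \<noteq> a (Suc s)" "a t \<noteq> a (Suc t)" for s t
    using less[of s t] less[of t s] that by linarith
  then obtain t where "{s. a s \<noteq> a (Suc s)} \<subseteq> {t}" by blast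
  from finite_subset[OF this] card_mono[OF _ this] show ?thesis by simp
qed

theorem theorem3p12:
  fixes f :: "nat \<Rightarrow> nat"
  assumes "approximable_from_above f"
  shows "\<exists>g :: nat \<Rightarrow> nat. n_approximable_from_below 2 g \<and> \<not> g \<le>\<^sub>m f"
proof -
  obtain g' where g': "computable2 g'" and g'_Suc: "\<And>x s. g' x (Suc s) \<le> g' x s"
    and lim: "\<And>x. (\<lambda>s. g' x s) \<longlonglongrightarrow> f x"
    using assms unfolding approximable_from_above_def by blast
  have g'_antimono: "g' x t \<le> g' x s" if "s \<le> t" for x s t
    using lift_Suc_antimono_le[of "g' x"] g'_Suc that by blast
  have g'_eventually: "\<exists>n. \<forall>s\<ge>n. g' x s = f x" for x
    using lim[of x] by (simp add: tendsto_discrete eventually_sequentially)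
  \<comment> \<open>The sum merges two conditions into one zero test: the control stack is empty,
    and the approximation at the output on top of the data stack is 0.\<close>
  define k where
    "k x s = (if pfst (run x s) + g' (pfst (psnd (run x s))) s = 0 then 1 else 0 :: nat)" for x s
  define g where "g x = (if \<exists>s. k x s = 1 then 1 else 0 :: nat)" for x
  have le_1: "k x s \<le> 1" for x s
    by (simp add: k_def)
  \<comment> \<open>After halting the output is fixed, and a decreasing approximation that is 0
    remains 0.\<close>
  have k_Suc: "k x s \<le> k x (Suc s)" for x s
    using run_halted[of x s "Suc s"] g'_Suc[of "pfst (psnd (run x s))" s] by (auto simp: k_def)
  have k_mono: "k x s \<le> k x t" if "s \<le> t" for x s t
    using lift_Suc_mono_le[of "k x"] k_Suc that by blast
  have "computable1 (\<lambda>z. if pfst (run (pfst z) (psnd z)) +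
      g' (pfst (psnd (run (pfst z) (psnd z)))) (psnd z) = 0 then 1 else 0)"
    by (intro computable1_if_eq computable1_add computable1_comp2[OF g']
        computable1_comp2[OF computable2_run] computable1_pfst computable1_psnd
        computable1_const computable1_id)
  from computable2_pair[OF this] have "computable2 k"
    by (simp add: k_def[abs_def])
  moreover have "(\<lambda>s. k x s) \<longlonglongrightarrow> g x" for x
  proof (cases "\<exists>s. k x s = 1")
    case True
    then obtain s where "k x s = 1" by blast
    then have "k x t = g x" if "t \<ge> s" for t
      using True k_mono[OF that, of x] le_1[of x t] by (simp add: g_def)
    then show ?thesis
      by (intro tendsto_eventually) (auto simp: eventually_sequentially)
  next
    case False
    then have "k x t = g x" for t
      using le_1[of x t] by (auto simp: g_def le_Suc_eq)
    then show ?thesis by simp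
  qed
  ultimately have "n_approximable_from_below 2 g"
    unfolding n_approximable_from_below_def
    using k_Suc card_changes_le_1[of "k _", OF k_Suc le_1]
    by (intro exI[of _ k]) (auto intro: le_trans[of _ 1 2])
  moreover have "\<not> g \<le>\<^sub>m f"
  proof
    assume "g \<le>\<^sub>m f"
    then obtain h c where c: "\<And>x. evaluates c [x] (h x)" and g: "g = f \<circ> h"
      unfolding many_one_reducible_def computable1_def by blast
    define e where "e = code c"
    obtain n where n: "run e n = pair 0 (pair (h e) 0)"
      using run_code[of c "h (code c)"] c unfolding e_def by blast
    obtain m where m: "\<And>s. s \<ge> m \<Longrightarrow> g' (h e) s = f (h e)"
      using g'_eventually by blast
    show False
    proof (cases "f (h e) = 0")
      case True
      \<comment> \<open>By stage \<open>max m n\<close> the run has halted and the approximation at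
        \<open>h e\<close> has settled.\<close>
      have "run e (max m n) = pair 0 (pair (h e) 0)"
        using run_halted[of e n "max m n"] n by simp
      then have "k e (max m n) = 1"
        using m[of "max m n"] True by (simp add: k_def)
      then have "g e = 1" by (auto simp: g_def)
      with g True show False by simp
    next
      case False
      have "k e s \<noteq> 1" for s
      proof
        assume "k e s = 1"
        then have halted: "pfst (run e s) = 0" and zero: "g' (pfst (psnd (run e s))) s = 0"
          by (auto simp: k_def split: if_splits)
        \<comment> \<open>Both stages are halted, so the later state equals the earlier one,
          whichever order they come in. Thus the output tested at stage \<open>s\<close> is
          \<open>h e\<close>.\<close>
        have "run e s = run e n"
          using run_halted[of e s n] run_halted[of e n s] halted n by (cases "s \<le> n") auto
        with zero n have "g' (h e) s = 0" by simp
        then have "f (h e) = 0"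
          using g'_antimono[of s "max m s" "h e"] m[of "max m s"] by simp
        with False show False ..
      qed
      then have "g e = 0" by (simp add: g_def)
      with g False show False by simp
    qed
  qed
  ultimately show ?thesis by blast
qed

end
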